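(* Let $q$ be a prime power, $n\ge1$, and $1\le k\le n$. Let $U\subseteq H_n(\mathbb{F}_{q^2})$ be a linear constant rank-distance $k$ set. Then \[ |U|\le \begin{cases} q^k & \text{if $k$ is odd},\\ q^{2n-k} & \text{if $k$ is even}.\end{cases} \]
   Context: $H_n(\mathbb{F}_{q^2})$ is the set of $n\times n$ matrices $A$ over $\mathbb{F}_{q^2}$ with $\overline{A}^T=A$, where $\overline{\cdot}$ applies $x\mapsto x^q$ entrywise; it is an $\mathbb{F}_q$-vector space. A constant rank-distance $k$ set is a set $U$ of $n\times n$ matrices such that $\mathrm{rank}(A-B)=k$ for all distinct $A,B\in U$ and $\mathrm{rank}(A)=k$ for all nonzero $A\in U$. It is called linear if it is closed under $F'$-linear combinations for some field $F'$ (here a subfield of $\mathbb{F}_q$); in particular it is closed under addition. *)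

theory Defs
  imports "HOL-Analysis.Analysis" "HOL-Number_Theory.Prime_Powers"
begin

(* The type 'a plays the role of the finite field with q^2 elements, in which the subfield with
   q elements is the set of fixed points of the involution x \<mapsto> x^q. *)

definition base_field :: "nat \<Rightarrow> 'a::field set" where
  "base_field q = {x. x ^ q = x}"

definition conj_transpose :: "nat \<Rightarrow> 'a::field ^ 'n ^ 'm \<Rightarrow> 'a ^ 'm ^ 'n" where
  "conj_transpose q A = transpose (map_matrix (\<lambda>x. x ^ q) A)"

definition hermitian_matrices :: "nat \<Rightarrow> ('a::field ^ 'n ^ 'n) set" where
  "hermitian_matrices q = {A. conj_transpose q A = A}"

definition constant_rank_distance :: "nat \<Rightarrow> ('a::field ^ 'n ^ 'n) set \<Rightarrow> bool" where
  "constant_rank_distance k U \<longleftrightarrow>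
     (\<forall>A\<in>U. \<forall>B\<in>U. A \<noteq> B \<longrightarrow> rank (A - B) = k) \<and>
     (\<forall>A\<in>U. A \<noteq> 0 \<longrightarrow> rank A = k)"

definition is_subfield :: "'a::field set \<Rightarrow> bool" where
  "is_subfield K \<longleftrightarrow> 0 \<in> K \<and> 1 \<in> K \<and>
     (\<forall>x\<in>K. \<forall>y\<in>K. x + y \<in> K \<and> x * y \<in> K) \<and>
     (\<forall>x\<in>K. - x \<in> K \<and> inverse x \<in> K)"

(* The empty linear combination is included, whence the requirement that 0 lies in U. *)
definition closed_under_linear_combinations ::
    "'a::field set \<Rightarrow> ('a ^ 'n ^ 'm) set \<Rightarrow> bool" where
  "closed_under_linear_combinations K U \<longleftrightarrow> 0 \<in> U \<and>
     (\<forall>a\<in>K. \<forall>b\<in>K. \<forall>A\<in>U. \<forall>B\<in>U.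
        map_matrix ((*) a) A + map_matrix ((*) b) B \<in> U)"

definition linear_set :: "'a::field set \<Rightarrow> ('a ^ 'n ^ 'm) set \<Rightarrow> bool" where
  "linear_set F U \<longleftrightarrow>
     (\<exists>K. is_subfield K \<and> K \<subseteq> F \<and> closed_under_linear_combinations K U)"

end

theory Submission
  imports Defs
begin

text \<open>
  Write \<open>h\<^sub>A(x)\<close> for the Hermitian form of \<open>A\<close>. If \<open>A\<close> has rank \<open>k\<close>, then \<open>h\<^sub>A\<close> takes each
  nonzero value of the subfield with \<open>q\<close> elements equally often, and the value 0 more often than 1 by
  \<open>(-1)\<^sup>k q\<^sup>2\<^sup>n\<^sup>-\<^sup>k\<close>: counting the pairs with \<open>h\<^sub>A(x) = h\<^sub>A(y)\<close> gives the absolute value of this difference,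
  and the free action of the \<open>q + 1\<close> elements of norm 1 on nonzero vectors gives its residue modulo
  \<open>q + 1\<close>, hence its sign.

  Choose an additive subgroup \<open>H\<close> of the field that is maximal subject to not containing 1, and let
  \<open>w\<close> be the indicator of \<open>H\<close> minus that of \<open>H + 1\<close>; it plays the role of an additive
  character. By maximality, the sum of \<open>w(h\<^sub>A(x))\<close> over \<open>A \<in> U\<close> is \<open>|U|\<close> or 0 for every fixed
  \<open>x\<close>. Summing over \<open>x\<close> and \<open>A\<close> in both orders yields
  \<open>q\<^sup>2\<^sup>n + (|U| - 1) (-1)\<^sup>k q\<^sup>2\<^sup>n\<^sup>-\<^sup>k = M |U|\<close> with \<open>M \<ge> 1\<close>. For odd \<open>k\<close> the bound follows from
  positivity; for even \<open>k\<close>, \<open>|U|\<close> divides \<open>q\<^sup>2\<^sup>n\<^sup>-\<^sup>k (q\<^sup>k - 1)\<close> and is coprime to the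
  second factor, since it divides a power of \<open>q\<close>.
\<close>

section \<open>Finite additive groups\<close>

definition additive_subgroup :: "'g::ab_group_add set \<Rightarrow> bool" where
  "additive_subgroup H \<longleftrightarrow> 0 \<in> H \<and> (\<forall>x\<in>H. \<forall>y\<in>H. x - y \<in> H)"

lemma additive_subgroupD:
  assumes "additive_subgroup H"
  shows "0 \<in> H"
    and "x \<in> H \<Longrightarrow> y \<in> H \<Longrightarrow> x - y \<in> H"
    and "x \<in> H \<Longrightarrow> - x \<in> H"
    and "x \<in> H \<Longrightarrow> y \<in> H \<Longrightarrow> x + y \<in> H"
proof -
  show zero: "0 \<in> H" and diff: "\<And>x y. x \<in> H \<Longrightarrow> y \<in> H \<Longrightarrow> x - y \<in> H"
    using assms by (auto simp: additive_subgroup_def)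
  show neg: "\<And>x. x \<in> H \<Longrightarrow> - x \<in> H"
    using diff[OF zero] by simp
  show "x \<in> H \<Longrightarrow> y \<in> H \<Longrightarrow> x + y \<in> H"
    using diff[of x "- y"] neg[of y] by simp
qed

text \<open>Lagrange's theorem: translates of \<open>H\<close> that meet coincide, so they partition
  the group. Applied to \<open>U\<close>, it makes \<open>card U\<close> divide a power of
  \<open>q\<close>.\<close>

lemma card_additive_subgroup_dvd:
  fixes H :: "'g::{ab_group_add,finite} set"
  assumes "additive_subgroup H"
  shows "card H dvd CARD('g)"
proof -
  let ?C = "range (\<lambda>x. (+) x ` H)"
  have disj: "(+) x ` H \<subseteq> (+) y ` H" if "x + g = y + h" "g \<in> H" "h \<in> H" for x y g h
  proof
    fix z assume "z \<in> (+) x ` H"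
    then obtain u where u: "u \<in> H" "z = x + u" by auto
    have "x = y + h - g" using that(1) by (simp add: algebra_simps eq_diff_eq)
    then have "z = y + (h - g + u)" using u by (simp add: algebra_simps)
    moreover have "h - g + u \<in> H"
      using that u additive_subgroupD[OF assms] by metis
    ultimately show "z \<in> (+) y ` H" by blast
  qed
  have "\<Union>?C = UNIV"
    using additive_subgroupD(1)[OF assms] by (auto intro!: image_eqI[of _ _ 0])
  moreover have "card H dvd card (\<Union>?C)"
  proof (rule dvd_partition)
    show "\<forall>c\<in>?C. card H dvd card c"
      by (auto simp: card_image)
    show "\<forall>c1\<in>?C. \<forall>c2\<in>?C. c1 \<noteq> c2 \<longrightarrow> c1 \<inter> c2 = {}"
    proof (intro ballI impI, rule ccontr)
      fix c1 c2 assume c: "c1 \<in> ?C" "c2 \<in> ?C" and ne: "c1 \<noteq> c2" and "c1 \<inter> c2 \<noteq> {}"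
      obtain x y where xy: "c1 = (+) x ` H" "c2 = (+) y ` H" using c by auto
      with \<open>c1 \<inter> c2 \<noteq> {}\<close> obtain g h where "x + g = y + h" "g \<in> H" "h \<in> H" by auto
      with disj[of x g y h] disj[of y h x g] ne xy show False by auto
    qed
  qed simp
  ultimately show ?thesis by simp
qed

lemma card_fibre_additive:
  fixes f :: "'g::{ab_group_add,finite} \<Rightarrow> 'h::ab_group_add"
  assumes add: "\<And>x y. f (x + y) = f x + f y" and y: "y \<in> range f"
  shows "card {x. f x = y} = card {x. f x = 0}"
proof -
  obtain x0 where x0: "f x0 = y" using y by auto
  have "{x. f x = y} = (+) x0 ` {x. f x = 0}"
  proof (intro equalityI subsetI)
    fix x assume "x \<in> {x. f x = y}"
    then have "f (x - x0) = 0" using add[of "x - x0" x0] x0 by simp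
    then show "x \<in> (+) x0 ` {x. f x = 0}" by (intro image_eqI[of _ _ "x - x0"]) auto
  qed (auto simp: add x0)
  then show ?thesis by (simp add: card_image)
qed

lemma card_UNIV_additive:
  fixes f :: "'g::{ab_group_add,finite} \<Rightarrow> 'h::ab_group_add"
  assumes add: "\<And>x y. f (x + y) = f x + f y"
  shows "CARD('g) = card (range f) * card {x. f x = 0}"
proof -
  have "CARD('g) = (\<Sum>y\<in>range f. card {x \<in> UNIV. f x = y})"
    using sum.group[of UNIV "range f" f "\<lambda>_. 1::nat"] by simp
  also have "\<dots> = (\<Sum>y\<in>range f. card {x. f x = 0})"
    using card_fibre_additive[of f] add by (intro sum.cong) auto
  finally show ?thesis by simp
qed

section \<open>A substitute for additive characters\<close>

lemma maximal_additive_subgroup_avoiding: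
  fixes c :: "'g::{ab_group_add,finite}"
  assumes "c \<noteq> 0"
  obtains H where "additive_subgroup H" "c \<notin> H"
    "\<And>G. additive_subgroup G \<Longrightarrow> H \<subset> G \<Longrightarrow> c \<in> G"
proof -
  let ?S = "{H. additive_subgroup H \<and> c \<notin> H}"
  have "{0} \<in> ?S" using assms by (auto simp: additive_subgroup_def)
  then obtain H where "H \<in> ?S" "\<And>G. G \<in> ?S \<Longrightarrow> H \<le> G \<Longrightarrow> H = G"
    using finite_has_maximal[of ?S] by (metis (no_types, lifting) empty_iff finite)
  then show ?thesis using that by blast
qed

lemma sum_coset_weight:
  fixes f :: "'u::ab_group_add \<Rightarrow> 'g::{ab_group_add,finite}"
  assumes H: "additive_subgroup H" "c \<notin> H"
      "\<And>G. additive_subgroup G \<Longrightarrow> H \<subset> G \<Longrightarrow> c \<in> G"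
    and U: "additive_subgroup U" "finite U"
    and add: "\<And>x y. f (x + y) = f x + f y"
  shows "(\<Sum>A\<in>U. of_bool (f A \<in> H) - of_bool (f A - c \<in> H) :: int)
    = (if f ` U \<subseteq> H then int (card U) else 0)"
proof (cases "f ` U \<subseteq> H")
  case True
  have "f A - c \<notin> H" if "A \<in> U" for A
    using that True H(2) additive_subgroupD(2)[OF H(1), of "f A" "f A - c"] by auto
  with True show ?thesis by (simp add: image_subset_iff)
next
  case False
  have diff: "f (x - y) = f x - f y" for x y
    using add[of "x - y" y] by (simp add: algebra_simps)
  let ?G = "{f A + h | A h. A \<in> U \<and> h \<in> H}"
  have "additive_subgroup ?G"
    unfolding additive_subgroup_def
  proof (intro conjI ballI)
    have "f 0 = 0" using diff[of 0 0] by simp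
    then show "0 \<in> ?G"
      using additive_subgroupD(1)[OF H(1)] additive_subgroupD(1)[OF U(1)]
      by (metis (mono_tags, lifting) add.right_neutral mem_Collect_eq)
  next
    fix x y assume "x \<in> ?G" "y \<in> ?G"
    then obtain A h B g where "x = f A + h" "y = f B + g" "A \<in> U" "B \<in> U" "h \<in> H" "g \<in> H"
      by auto
    then have "x - y = f (A - B) + (h - g)" "A - B \<in> U" "h - g \<in> H"
      using additive_subgroupD(2)[OF H(1)] additive_subgroupD(2)[OF U(1)]
      by (auto simp: diff algebra_simps)
    then show "x - y \<in> ?G" by blast
  qed
  moreover have "H \<subset> ?G"
  proof -
    have "f 0 = 0" using diff[of 0 0] by simp
    then have "H \<subseteq> ?G"
      using additive_subgroupD(1)[OF U(1)] by (smt (verit) add_0 mem_Collect_eq subsetI)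
    moreover have "f ` U \<subseteq> ?G"
      using additive_subgroupD(1)[OF H(1)] by (auto) (metis add.right_neutral)
    ultimately show ?thesis using False by auto
  qed
  ultimately have "c \<in> ?G" by (rule H(3))
  then obtain A0 h where A0: "A0 \<in> U" "h \<in> H" "c = f A0 + h" by auto
  have shift: "f (A + A0) - c \<in> H \<longleftrightarrow> f A \<in> H" for A
  proof -
    have "f (A + A0) - c = f A - h" using A0 by (simp add: add algebra_simps)
    then show ?thesis
      using A0(2) additive_subgroupD(2)[OF H(1), of "f A" h]
        additive_subgroupD(4)[OF H(1), of "f A - h" h] by auto
  qed
  have "(\<Sum>A\<in>U. of_bool (f A \<in> H) :: int) = (\<Sum>A\<in>U. of_bool (f A - c \<in> H))"
    by (rule sum.reindex_bij_witness[of _ "\<lambda>A. A - A0" "\<lambda>A. A + A0"])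
      (use A0 shift additive_subgroupD[OF U(1)] in auto)
  with False show ?thesis by (simp add: sum_subtractf)
qed

section \<open>The field with \<open>q\<^sup>2\<close> elements\<close>

lemma power_CARD_eq_same:
  fixes x :: "'a::{field,finite}"
  shows "x ^ CARD('a) = x"
proof (cases "x = 0")
  case False
  have "(\<Prod>y\<in>- {0}. y) = (\<Prod>y\<in>- {0}. x * y)"
    by (rule prod.reindex_bij_witness[of _ "\<lambda>y. x * y" "\<lambda>y. y / x"]) (use False in auto)
  also have "\<dots> = x ^ card (- {0::'a}) * (\<Prod>y\<in>- {0}. y)"
    by (simp add: prod.distrib)
  finally have "x ^ card (- {0::'a}) = 1" by simp
  moreover have "CARD('a) = Suc (card (- {0::'a}))"
    by (simp add: card_Diff_singleton Compl_eq_Diff_UNIV)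
  ultimately show ?thesis by simp
qed simp

text \<open>The solutions are the roots of a polynomial of degree \<open>n\<close>. It is used with
  \<open>r\<close> equal to X (base field), a constant (norm fibres) and -X (kernel of the
  trace).\<close>

lemma card_power_eq_poly_le:
  fixes r :: "'a::field poly"
  assumes "degree r < n"
  shows "card {x. x ^ n = poly r x} \<le> n"
proof -
  let ?p = "monom 1 n - r"
  have deg: "degree ?p = n"
    using assms degree_add_eq_left[of "- r" "monom 1 n"] by (simp add: degree_monom_eq)
  then have "?p \<noteq> 0" using assms by auto
  from card_poly_roots_bound[OF this] show ?thesis
    by (simp add: deg poly_monom)
qed

context
  fixes q :: nat
  assumes q: "primepow q" and CARD_q: "CARD('a::{field,finite}) = q ^ 2"
begin

lemma q_gt_1: "q > 1"
  using primepow_gt_Suc_0[OF q] by simp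

lemma frobenius_add: "(x + y) ^ q = x ^ q + (y::'a) ^ q"
proof -
  obtain p m where pm: "prime p" "m > 0" "q = p ^ m"
    using q by (auto simp: primepow_def)
  have prime: "prime CHAR('a)"
    using prime_CHAR_semidom finite_imp_CHAR_pos finite by metis
  have "of_nat (CARD('a)) = (0 :: 'a)"
  proof -
    \<comment> \<open>Translation by 1 permutes the field, so adding 1 to every summand, that is
      \<open>CARD('a)\<close> in total, changes nothing.\<close>
    have "(\<Sum>x\<in>UNIV. x) = (\<Sum>x\<in>UNIV. x + (1::'a))"
      by (rule sum.reindex_bij_witness[of _ "\<lambda>x. x + 1" "\<lambda>x. x - 1"]) auto
    then show ?thesis by (simp add: sum.distrib)
  qed
  then have "CHAR('a) dvd p"
    by (simp add: CARD_q pm of_nat_eq_0_iff_char_dvd)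
  then have "CHAR('a) = p"
    using prime pm(1) primes_dvd_imp_eq by blast
  then show ?thesis
    using freshmans_dream'[OF prime] pm by simp
qed

lemma frobenius_frobenius: "((x::'a) ^ q) ^ q = x"
  using power_CARD_eq_same[of x] by (simp add: CARD_q power_mult power2_eq_square)

lemma frobenius_minus: "(- (x::'a)) ^ q = - (x ^ q)"
  using frobenius_add[of x "- x"] q_gt_1 by (simp add: zero_power eq_neg_iff_add_eq_0 add.commute)

lemma frobenius_sum: "(\<Sum>i\<in>I. f i) ^ q = (\<Sum>i\<in>I. (f i :: 'a) ^ q)"
  using q_gt_1 by (induction I rule: infinite_finite_induct) (auto simp: frobenius_add zero_power)

lemma norm_in_base_field: "(x::'a) ^ (q + 1) \<in> base_field q"
  using frobenius_frobenius[of x] by (simp add: base_field_def power_mult_distrib mult.commute)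

text \<open>Both counts come from one saturated estimate: the norm sends the
  \<open>q ^ 2 - 1\<close> nonzero elements into at most \<open>q - 1\<close> values, each with at
  most \<open>q + 1\<close> preimages. Since the bounds multiply to the exact total, both are
  attained.\<close>

lemma card_base_field_nonzero: "card (base_field q - {0::'a}) = q - 1" (is ?A)
  and card_norm_fibre: "c \<in> base_field q \<Longrightarrow> c \<noteq> 0 \<Longrightarrow> card {x::'a. x ^ (q + 1) = c} = q + 1"
proof -
  let ?B = "base_field q - {0::'a}"
  have zero: "0 \<in> (base_field q :: 'a set)" using q_gt_1 by (simp add: base_field_def)
  have "card (base_field q :: 'a set) \<le> q"
    using card_power_eq_poly_le[of "[:0, 1::'a:]" q] q_gt_1 by (simp add: base_field_def)
  then have B_le: "card ?B \<le> q - 1" using zero by (simp add: card_Diff_singleton)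
  have fib_le: "card {x::'a. x ^ (q + 1) = c} \<le> q + 1" for c
    using card_power_eq_poly_le[of "[:c:]" "q + 1"] by simp
  have "q ^ 2 - 1 = card (- {0::'a})"
    by (simp add: card_Diff_singleton Compl_eq_Diff_UNIV CARD_q)
  also have "\<dots> = (\<Sum>c\<in>?B. card {x \<in> - {0::'a}. x ^ (q + 1) = c})"
  proof -
    have "(\<lambda>x::'a. x ^ (q + 1)) ` (- {0}) \<subseteq> ?B"
      by (intro image_subsetI DiffI norm_in_base_field) auto
    then show ?thesis
      using sum.group[of "- {0::'a}" ?B "\<lambda>x. x ^ (q + 1)" "\<lambda>_. 1::nat"] by simp
  qed
  also have "\<dots> = (\<Sum>c\<in>?B. card {x::'a. x ^ (q + 1) = c})"
    by (intro sum.cong arg_cong[of _ _ card]) auto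
  finally have sum: "q ^ 2 - 1 = (\<Sum>c\<in>?B. card {x::'a. x ^ (q + 1) = c})" .
  have sq: "q ^ 2 - 1 = (q - 1) * (q + 1)"
    by (cases q) (simp_all add: power2_eq_square)
  have "(q - 1) * (q + 1) \<le> (\<Sum>c\<in>?B. q + 1)"
    unfolding sq[symmetric] sum by (intro sum_mono fib_le)
  then have "(q - 1) * (q + 1) \<le> card ?B * (q + 1)" by (simp only: sum_constant of_nat_id)
  then have "q - 1 \<le> card ?B" by (simp only: mult_le_cancel2)
  then show cB: ?A using B_le by simp
  show "card {x::'a. x ^ (q + 1) = c} = q + 1" if c: "c \<in> base_field q" "c \<noteq> 0" for c
  proof (rule ccontr)
    assume "card {x::'a. x ^ (q + 1) = c} \<noteq> q + 1"
    with fib_le[of c] have "card {x::'a. x ^ (q + 1) = c} < q + 1" by simp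
    then have "(\<Sum>c\<in>?B. card {x::'a. x ^ (q + 1) = c}) < (\<Sum>c\<in>?B. q + 1)"
      using c fib_le by (intro sum_strict_mono_ex1) auto
    then show False using sum sq cB by simp
  qed
qed

lemma card_base_field: "card (base_field q :: 'a set) = q"
  using card_base_field_nonzero q_gt_1 card_Diff_singleton[of 0 "base_field q :: 'a set"]
  by (simp add: base_field_def zero_power)

lemma trace_in_base_field: "(x::'a) + x ^ q \<in> base_field q"
  by (simp add: base_field_def frobenius_add frobenius_frobenius add.commute)

text \<open>Image and kernel have at most \<open>q\<close> elements each, while their cardinalities
  multiply to \<open>q ^ 2\<close>.\<close>

lemma range_trace: "range (\<lambda>x::'a. x + x ^ q) = base_field q"
proof (rule card_subset_eq)
  show "range (\<lambda>x::'a. x + x ^ q) \<subseteq> base_field q" using trace_in_base_field by blast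
  then have le: "card (range (\<lambda>x::'a. x + x ^ q)) \<le> q"
    using card_mono[of "base_field q :: 'a set"] card_base_field by simp
  have "{x::'a. x + x ^ q = 0} = {x. x ^ q = poly [:0, -1:] x}"
    by (auto simp: add_eq_0_iff) 
  then have ker: "card {x::'a. x + x ^ q = 0} \<le> q"
    using card_power_eq_poly_le[of "[:0, -1::'a:]" q] q_gt_1 by simp
  have "q * q = card (range (\<lambda>x::'a. x + x ^ q)) * card {x::'a. x + x ^ q = 0}"
    using card_UNIV_additive[of "\<lambda>x::'a. x + x ^ q"]
    by (simp add: frobenius_add algebra_simps CARD_q power2_eq_square)
  also have "\<dots> \<le> card (range (\<lambda>x::'a. x + x ^ q)) * q"
    using ker by simp
  finally show "card (range (\<lambda>x::'a. x + x ^ q)) = card (base_field q :: 'a set)"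
    using le q_gt_1 card_base_field by simp
qed simp

end

section \<open>Cardinalities of row spaces and kernels\<close>

lemma card_span_finite_field:
  fixes S :: "('a::{field,finite} ^ 'n) set"
  shows "card (vec.span S) = CARD('a) ^ vec.dim S"
proof -
  obtain B where B: "B \<subseteq> S" "vec.independent B" "S \<subseteq> vec.span B" "card B = vec.dim S"
    using vec.basis_exists by blast
  have span: "vec.span S = vec.span B"
    using B vec.span_mono vec.span_minimal[OF B(3) vec.subspace_span] by blast
  let ?g = "\<lambda>f. \<Sum>b\<in>B. f b *s b"
  \<comment> \<open>Extensional functions fix the values outside \<open>B\<close>, which makes
    coordinate functions unique.\<close>
  let ?P = "B \<rightarrow>\<^sub>E (UNIV :: 'a set)"
  have "inj_on ?g ?P"
  proof (rule inj_onI)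
    fix f h assume f: "f \<in> ?P" "h \<in> ?P" and "?g f = ?g h"
    then have "(\<Sum>b\<in>B. (f b - h b) *s b) = 0"
      by (simp add: vec.scale_left_diff_distrib sum_subtractf)
    then have "f b = h b" if "b \<in> B" for b
      using vec.independentD[OF B(2), of B "\<lambda>b. f b - h b" b] that by simp
    with f show "f = h" by (intro PiE_ext) auto
  qed
  then have "card (?g ` ?P) = card ?P" by (rule card_image)
  moreover have "?g ` ?P = vec.span B"
  proof
    show "?g ` ?P \<subseteq> vec.span B"
      by (intro image_subsetI vec.span_sum vec.span_scale vec.span_base)
    show "vec.span B \<subseteq> ?g ` ?P"
    proof
      fix v assume "v \<in> vec.span B"
      then obtain u where "v = ?g u"
        using vec.span_finite[OF finite[of B]] by auto
      then have "v = ?g (restrict u B)" by simp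
      moreover have "restrict u B \<in> ?P" by simp
      ultimately show "v \<in> ?g ` ?P" by (rule image_eqI)
    qed
  qed
  ultimately show ?thesis using B(4) span by (simp add: card_PiE)
qed

lemma range_vector_matrix_mult:
  fixes A :: "'a::field ^ 'n ^ 'm"
  shows "range (\<lambda>x. x v* A) = vec.span (rows A)"
proof
  show "range (\<lambda>x. x v* A) \<subseteq> vec.span (rows A)"
    using matrix_vector_mult_in_columnspace_gen[of "transpose A"] by (auto simp: columns_transpose)
  have "vec.subspace (range (\<lambda>x. x v* A))"
  proof (rule vec.subspaceI)
    show "0 \<in> range (\<lambda>x. x v* A)" by (rule range_eqI[of _ _ 0]) simp
    show "y + z \<in> range (\<lambda>x. x v* A)"
      if "y \<in> range (\<lambda>x. x v* A)" "z \<in> range (\<lambda>x. x v* A)" for y z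
      using that by (auto simp flip: vector_matrix_left_distrib)
    show "c *s y \<in> range (\<lambda>x. x v* A)" if "y \<in> range (\<lambda>x. x v* A)" for c y
      using that by (auto simp flip: scalar_vector_matrix_assoc)
  qed
  moreover have row: "axis i 1 v* A = row i A" for i
    by (simp add: vec_eq_iff vector_matrix_mult_def row_def axis_def if_distrib[of "\<lambda>x. x * _"] cong: if_cong)
  have "rows A \<subseteq> range (\<lambda>x. x v* A)"
    by (auto simp: rows_def simp flip: row)
  ultimately show "vec.span (rows A) \<subseteq> range (\<lambda>x. x v* A)"
    by (rule vec.span_minimal[rotated])
qed

text \<open>Rank-nullity in counting form. It is stated for multiplication from the left because the
  conjugated argument of \<open>sesq\<close> acts on that side.\<close>

lemma card_left_kernel:
  fixes A :: "'a::{field,finite} ^ 'n ^ 'm"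
  shows "CARD('a) ^ rank A * card {x. x v* A = 0} = CARD('a) ^ CARD('m)"
  using card_UNIV_additive[of "\<lambda>x. x v* A"]
  by (simp add: range_vector_matrix_mult card_span_finite_field row_rank_def_gen algebra_simps)

section \<open>Hermitian forms\<close>

definition sesq :: "nat \<Rightarrow> 'a::field ^ 'n ^ 'm \<Rightarrow> 'a ^ 'm \<Rightarrow> 'a ^ 'n \<Rightarrow> 'a" where
  "sesq q A x y = (\<Sum>i\<in>UNIV. \<Sum>j\<in>UNIV. x $ i ^ q * A $ i $ j * y $ j)"

abbreviation herm :: "nat \<Rightarrow> 'a::field ^ 'n ^ 'n \<Rightarrow> 'a ^ 'n \<Rightarrow> 'a" where
  "herm q A x \<equiv> sesq q A x x"

lemma sesq_eq_left_mult:
  "sesq q A x y = (\<Sum>j\<in>UNIV. ((\<chi> i. x $ i ^ q) v* A) $ j * y $ j)"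
  unfolding sesq_def vector_matrix_mult_def
  by (subst sum.swap) (simp add: sum_distrib_right)

lemma sesq_add_right: "sesq q A x (y + z) = sesq q A x y + sesq q A x z"
  by (simp add: sesq_def algebra_simps sum.distrib)

lemma sesq_add_matrix: "sesq q (A + B) x y = sesq q A x y + sesq q B x y"
  by (simp add: sesq_def algebra_simps sum.distrib)

lemma herm_scale: "herm q A (c *s x) = c ^ (q + 1) * herm q A x"
  by (simp add: sesq_def power_mult_distrib sum_distrib_left mult_ac)

context
  fixes q :: nat
  assumes q: "primepow q" and CARD_q: "CARD('a::{field,finite}) = q ^ 2"
begin

lemma sesq_add_left: "sesq q A (x + y) z = sesq q A x z + sesq q (A :: 'a ^ 'n ^ 'm) y z"
  by (simp add: sesq_def frobenius_add[OF q CARD_q] algebra_simps sum.distrib)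

lemma sesq_hermitian:
  assumes A: "A \<in> (hermitian_matrices q :: ('a ^ 'n ^ 'n) set)"
  shows "sesq q A y x = sesq q A x y ^ q"
proof -
  have "(A $ i $ j) ^ q = A $ j $ i" for i j
  proof -
    have "conj_transpose q A $ j $ i = (A $ i $ j) ^ q"
      by (simp add: conj_transpose_def transpose_def map_matrix_def)
    then show ?thesis using A by (simp add: hermitian_matrices_def)
  qed
  then have "sesq q A x y ^ q = (\<Sum>i\<in>UNIV. \<Sum>j\<in>UNIV. x $ i * A $ j $ i * y $ j ^ q)"
    by (simp add: sesq_def frobenius_sum[OF q CARD_q] power_mult_distrib frobenius_frobenius[OF q CARD_q])
  then show ?thesis
    by (subst (asm) sum.swap) (simp add: sesq_def mult_ac)
qed

lemma herm_in_base_field: "A \<in> hermitian_matrices q \<Longrightarrow> herm q A (x :: 'a ^ 'n) \<in> base_field q"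
  using sesq_hermitian[of A x x] by (simp add: base_field_def)

lemma herm_add:
  assumes "A \<in> (hermitian_matrices q :: ('a ^ 'n ^ 'n) set)"
  shows "herm q A (x + z) = herm q A x + (sesq q A z x + sesq q A z x ^ q) + herm q A z"
  using sesq_hermitian[OF assms, of x z] by (simp add: sesq_add_left sesq_add_right)

text \<open>Entrywise Frobenius is an involution on vectors and exchanges the two kernels.\<close>

lemma card_conj_left_kernel:
  "card {x::'a ^ 'm. (\<chi> i. x $ i ^ q) v* (A :: 'a ^ 'n ^ 'm) = 0} = card {x. x v* A = 0}"
  by (rule bij_betw_same_card[of "\<lambda>x. \<chi> i. x $ i ^ q"], rule bij_betwI[of _ _ _ "\<lambda>x. \<chi> i. x $ i ^ q"])
    (auto simp: frobenius_frobenius[OF q CARD_q])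

text \<open>For \<open>z\<close> outside the radical, the trace of \<open>sesq q A z x\<close> is an
  additive map of \<open>x\<close> onto the base field, so its \<open>q\<close> fibres are equally
  large.\<close>

lemma card_trace_sesq_fibre:
  fixes A :: "'a ^ 'n ^ 'm"
  assumes z: "(\<chi> i. z $ i ^ q) v* A \<noteq> 0" and c: "c \<in> base_field q"
  shows "q * card {x. sesq q A z x + sesq q A z x ^ q = c} = CARD('a ^ 'n)"
proof -
  let ?f = "\<lambda>x. sesq q A z x + sesq q A z x ^ q"
  have add: "?f (x + y) = ?f x + ?f y" for x y
    by (simp add: sesq_add_right frobenius_add[OF q CARD_q] algebra_simps)
  obtain j where j: "((\<chi> i. z $ i ^ q) v* A) $ j \<noteq> 0" (is "?w \<noteq> 0") using z by (auto simp: vec_eq_iff)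
  \<comment> \<open>A vector supported on one coordinate where the functional is nonzero realises
    any prescribed value.\<close>
  have "sesq q A z (axis j (t / ?w)) = t" for t
    using j by (simp add: sesq_eq_left_mult axis_def if_distrib[of "\<lambda>x. _ * x"] cong: if_cong)
  then have "t + t ^ q \<in> range ?f" for t
    using rangeI[of ?f "axis j (t / ?w)"] by simp
  then have "range (\<lambda>t. t + t ^ q) \<subseteq> range ?f" by blast
  moreover have "range ?f \<subseteq> base_field q" using trace_in_base_field[OF q CARD_q] by blast
  ultimately have range: "range ?f = base_field q" unfolding range_trace[OF q CARD_q] by blast
  have "card {x. ?f x = c} = card {x. ?f x = 0}"
    using c range by (intro card_fibre_additive add) simp
  then show ?thesis
    using card_UNIV_additive[of ?f] add range card_base_field[OF q CARD_q] by metis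
qed

section \<open>Value distribution of a Hermitian form\<close>

text \<open>Pairs are parametrised by their difference \<open>z\<close>. Expanding
  \<open>herm q A (x + z)\<close> turns a collision into a trace condition on \<open>x\<close>:
  every \<open>x\<close> satisfies it if \<open>z\<close> lies in the radical, and one in
  \<open>q\<close> otherwise.\<close>

lemma card_herm_collisions:
  fixes A :: "'a ^ 'n ^ 'n"
  assumes A: "A \<in> hermitian_matrices q"
  defines "V \<equiv> int (CARD('a ^ 'n))" and "K \<equiv> int (card {x. x v* A = 0})"
  shows "int q * int (card {(x, y). herm q A x = herm q A y}) = V ^ 2 + (int q - 1) * V * K"
proof -
  let ?K = "{z::'a ^ 'n. (\<chi> i. z $ i ^ q) v* A = 0}"
  let ?N = "\<lambda>z. {x. herm q A (x + z) = herm q A x}"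
  have fib: "int q * int (card (?N z)) = (if z \<in> ?K then int q * V else V)" for z
  proof (cases "z \<in> ?K")
    case True
    then have "sesq q A z x = 0" for x by (simp add: sesq_eq_left_mult)
    \<comment> \<open>The case \<open>x = z\<close> also makes the last term
      \<open>herm q A z\<close> vanish.\<close>
    then have "?N z = UNIV" using q_gt_1[OF q CARD_q] by (simp add: herm_add[OF A] zero_power)
    with True show ?thesis by (simp add: V_def)
  next
    case False
    have "?N z = {x. sesq q A z x + sesq q A z x ^ q = - herm q A z}"
      unfolding herm_add[OF A] by (simp add: eq_neg_iff_add_eq_0 add.assoc)
    moreover have "- herm q A z \<in> base_field q"
      using herm_in_base_field[OF A, of z] by (simp add: base_field_def frobenius_minus[OF q CARD_q])
    ultimately have "q * card (?N z) = CARD('a ^ 'n)"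
      using card_trace_sesq_fibre[of z A] False by simp
    then have "int (q * card (?N z)) = V" by (simp only: V_def)
    with False show ?thesis by (simp only: of_nat_mult if_False)
  qed
  have "card {(x, y). herm q A x = herm q A y} = card (Sigma UNIV ?N)"
  proof -
    let ?g = "\<lambda>(z, y). (y + z, y)"
    have "?g ` Sigma UNIV ?N = {(x, y). herm q A x = herm q A y}"
    proof (intro equalityI subsetI)
      fix p assume "p \<in> {(x, y). herm q A x = herm q A y}"
      then obtain x y where p: "p = (x, y)" "herm q A x = herm q A y" by blast
      have "y + (x - y) = x" by simp
      with p have "p = ?g (x - y, y)" "(x - y, y) \<in> Sigma UNIV ?N" by simp_all
      then show "p \<in> ?g ` Sigma UNIV ?N" by (rule image_eqI)
    qed fastforce
    moreover have "inj_on ?g (Sigma UNIV ?N)" by (auto simp: inj_on_def)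
    then have "card (?g ` Sigma UNIV ?N) = card (Sigma UNIV ?N)" by (rule card_image)
    ultimately show ?thesis by simp
  qed
  also have "\<dots> = (\<Sum>z\<in>UNIV. card (?N z))" by simp
  finally have "int q * int (card {(x, y). herm q A x = herm q A y}) = (\<Sum>z\<in>UNIV. int q * int (card (?N z)))"
    by (simp only: of_nat_sum sum_distrib_left)
  also have "\<dots> = (\<Sum>z\<in>UNIV. (if z \<in> ?K then (int q - 1) * V else 0) + V)"
    unfolding fib by (intro sum.cong) (auto simp: algebra_simps)
  also have "\<dots> = (int q - 1) * V * int (card ?K) + V * V"
  proof -
    have "(\<Sum>z\<in>UNIV. if z \<in> ?K then (int q - 1) * V else 0) = (\<Sum>z\<in>?K. (int q - 1) * V)"
      by (rule sum.mono_neutral_cong_right) auto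
    then show ?thesis by (simp add: sum.distrib V_def)
  qed
  finally show ?thesis by (simp add: card_conj_left_kernel K_def power2_eq_square)
qed

text \<open>Scaling vectors by an element of norm \<open>c\<close> multiplies the form by
  \<open>c\<close>; such an element exists because the norm fibre is nonempty.\<close>

lemma card_herm_fibre_eq:
  fixes A :: "'a ^ 'n ^ 'n"
  assumes c: "c \<in> base_field q" "c \<noteq> 0"
  shows "card {x. herm q A x = c} = card {x. herm q A x = 1}"
proof -
  have "card {x::'a. x ^ (q + 1) = c} > 0" using card_norm_fibre[OF q CARD_q c] by simp
  then obtain l :: 'a where l: "l ^ (q + 1) = c" by (auto simp: card_gt_0_iff simp del: power_Suc)
  then have "l \<noteq> 0" using c by auto
  show ?thesis
    by (rule bij_betw_same_card[of "\<lambda>x. inverse l *s x"], rule bij_betwI[of _ _ _ "\<lambda>x. l *s x"])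
      (use l \<open>l \<noteq> 0\<close> c in \<open>auto simp: herm_scale power_inverse simp del: power_Suc\<close>)
qed

text \<open>The \<open>q + 1\<close> scalars of norm 1 act freely on nonzero vectors, so
  \<open>S\<close> splits into orbits of size \<open>q + 1\<close>.\<close>

lemma norm_one_invariant_card_dvd:
  fixes S :: "('a ^ 'n) set"
  assumes inv: "\<And>t x. t ^ (q + 1) = 1 \<Longrightarrow> x \<in> S \<Longrightarrow> t *s x \<in> S" and "0 \<notin> S"
  shows "q + 1 dvd card S"
proof -
  let ?T = "{t::'a. t ^ (q + 1) = 1}"
  let ?orb = "\<lambda>x. (\<lambda>t. t *s x) ` ?T"
  have sub: "?orb x \<subseteq> ?orb y" if "s *s x = t *s y" "s \<in> ?T" "t \<in> ?T" for s t x y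
  proof
    fix z assume "z \<in> ?orb x"
    then obtain u where u: "u \<in> ?T" "z = u *s x" by auto
    have "s \<noteq> 0" using that by auto
    then have "x = inverse s *s (s *s x)" by simp
    also have "\<dots> = (inverse s * t) *s y" by (simp add: that)
    finally have "z = (u * (inverse s * t)) *s y" using u by simp
    moreover have "u * (inverse s * t) \<in> ?T"
      using u that by (simp add: power_mult_distrib power_inverse del: power_Suc)
    ultimately show "z \<in> ?orb y" by blast
  qed
  have "\<Union>(?orb ` S) = S"
    using inv by (auto intro!: image_eqI[of _ _ 1] simp del: power_Suc)
  moreover have "q + 1 dvd card (\<Union>(?orb ` S))"
  proof (rule dvd_partition)
    have "card (?orb x) = q + 1" if "x \<in> S" for x
    proof -
      have "x \<noteq> 0" using that \<open>0 \<notin> S\<close> by auto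
      then have "inj_on (\<lambda>t. t *s x) ?T" by (auto simp: inj_on_def)
      then show ?thesis
        using card_norm_fibre[OF q CARD_q, of 1] by (simp add: card_image base_field_def)
    qed
    then show "\<forall>c\<in>?orb ` S. q + 1 dvd card c" by auto
    show "\<forall>c1\<in>?orb ` S. \<forall>c2\<in>?orb ` S. c1 \<noteq> c2 \<longrightarrow> c1 \<inter> c2 = {}"
    proof (intro ballI impI, rule ccontr)
      fix c1 c2 assume c: "c1 \<in> ?orb ` S" "c2 \<in> ?orb ` S" and ne: "c1 \<noteq> c2" and "c1 \<inter> c2 \<noteq> {}"
      obtain x y where xy: "c1 = ?orb x" "c2 = ?orb y" using c by auto
      with \<open>c1 \<inter> c2 \<noteq> {}\<close> obtain s t where "s *s x = t *s y" "s \<in> ?T" "t \<in> ?T" by blast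
      with sub[of s x t y] sub[of t y s x] ne xy show False by simp
    qed
  qed simp
  ultimately show ?thesis by simp
qed

text \<open>The first and second moments of the fibre sizes determine \<open>(a - b) ^ 2\<close>;
  congruences modulo \<open>q + 1\<close> then select the sign. The rank hypothesis makes the
  natural-number subtraction in the exponent exact.\<close>

lemma herm_fibre_difference:
  fixes A :: "'a ^ 'n ^ 'n"
  assumes A: "A \<in> hermitian_matrices q" and "rank A \<le> 2 * CARD('n)"
  shows "int (card {x. herm q A x = 0}) - int (card {x. herm q A x = 1})
    = (-1) ^ rank A * int q ^ (2 * CARD('n) - rank A)"
proof -
  let ?B = "base_field q :: 'a set"
  define a where "a = int (card {x. herm q A x = 0})"
  define b where "b = int (card {x. herm q A x = 1})"
  define V where "V = int (CARD('a ^ 'n))"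
  define K where "K = int (card {x. x v* A = 0})"
  define W where "W = int q ^ (2 * CARD('n) - rank A)"
  have q1: "int q > 1" using q_gt_1[OF q CARD_q] by simp
  have zero: "0 \<in> ?B" using q1 by (simp add: base_field_def zero_power)
  have fib: "int (card {x. herm q A x = c}) = b" if "c \<in> ?B - {0}" for c
    using card_herm_fibre_eq[of c A] that by (simp add: b_def)
  have cB: "int (card (?B - {0})) = int q - 1"
    using card_base_field_nonzero[OF q CARD_q] q1 by simp
  have img: "range (herm q A) \<subseteq> ?B" using herm_in_base_field[OF A] by blast
  have "CARD('a ^ 'n) = (\<Sum>c\<in>?B. card {x. herm q A x = c})"
    using sum.group[OF finite finite img, of "\<lambda>_. 1::nat"] by simp
  then have "V = (\<Sum>c\<in>?B. int (card {x. herm q A x = c}))" by (simp add: V_def)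
  also have "\<dots> = a + (\<Sum>c\<in>?B - {0}. int (card {x. herm q A x = c}))"
    using zero by (simp add: sum.remove a_def)
  finally have V: "V = a + (int q - 1) * b" using fib cB by simp
  have "{(x, y). herm q A x = herm q A y} = Sigma UNIV (\<lambda>x. {y. herm q A y = herm q A x})" by auto
  then have "card {(x, y). herm q A x = herm q A y} = (\<Sum>x\<in>UNIV. card {y. herm q A y = herm q A x})"
    by simp
  also have "\<dots> = (\<Sum>c\<in>?B. card {x. herm q A x = c} * card {x. herm q A x = c})"
    using sum_fun_comp[OF finite finite img, of "\<lambda>c. card {y. herm q A y = c}"] by simp
  finally have "int (card {(x, y). herm q A x = herm q A y})
      = (\<Sum>c\<in>?B. int (card {x. herm q A x = c}) ^ 2)"
    by (simp add: power2_eq_square)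
  also have "\<dots> = a ^ 2 + (\<Sum>c\<in>?B - {0}. int (card {x. herm q A x = c}) ^ 2)"
    using zero by (simp add: sum.remove a_def)
  also have "\<dots> = a ^ 2 + (int q - 1) * b ^ 2" using fib cB by simp
  finally have "int q * (a ^ 2 + (int q - 1) * b ^ 2) = V ^ 2 + (int q - 1) * V * K"
    using card_herm_collisions[OF A] by (simp add: V_def K_def)
  \<comment> \<open>This rests on the variance identity \<open>q * (a ^ 2 + (q - 1) * b ^ 2) - V ^ 2
    = (q - 1) * (a - b) ^ 2\<close>.\<close>
  then have "(int q - 1) * (a - b) ^ 2 = (int q - 1) * (V * K)"
    unfolding V by algebra
  then have sq: "(a - b) ^ 2 = V * K" using q1 by simp
  have "q ^ (2 * rank A) * card {x. x v* A = 0} = CARD('a ^ 'n)"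
    using card_left_kernel[of A] by (simp add: CARD_q power_mult)
  then have K: "int q ^ (2 * rank A) * K = V"
    unfolding K_def V_def by (metis of_nat_mult of_nat_power)
  have V_W: "V = W * int q ^ rank A"
    using assms(2) by (simp add: V_def W_def CARD_q flip: power_mult power_add)
  have "int q ^ (2 * rank A) * (V * K) = V * V"
    using K by (simp add: mult.left_commute)
  also have "\<dots> = int q ^ (2 * rank A) * W ^ 2"
    by (simp add: V_W power_even_eq power2_eq_square)
  finally have "int q ^ (2 * rank A) * (V * K) = int q ^ (2 * rank A) * W ^ 2" .
  then have "(a - b) ^ 2 = W ^ 2" using q1 sq by simp
  then have ab: "a - b = W \<or> a - b = - W" by (simp add: power2_eq_iff)
  \<comment> \<open>The zero vector is fixed by all scalars and must be removed, which gives
    \<open>a\<close> the residue 1; the fibre over 1 does not contain it, so \<open>b\<close> has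
    residue 0.\<close>
  have "q + 1 dvd card ({x. herm q A x = 0} - {0})"
    by (rule norm_one_invariant_card_dvd) (auto simp: herm_scale simp del: power_Suc)
  then have "int (q + 1) dvd int (card ({x. herm q A x = 0} - {0}))" by (simp only: of_nat_dvd_iff)
  moreover have zero_zero: "herm q A 0 = 0" by (simp add: sesq_def)
  then have "a - 1 = int (card ({x. herm q A x = 0} - {0}))"
    unfolding a_def using card.remove[OF finite, of 0 "{x. herm q A x = 0}"] by simp
  ultimately have "int q + 1 dvd a - 1" by (simp add: add.commute)
  moreover have "q + 1 dvd card {x. herm q A x = 1}"
    by (rule norm_one_invariant_card_dvd) (auto simp: herm_scale zero_zero simp del: power_Suc)
  then have "int (q + 1) dvd b" unfolding b_def by (simp only: of_nat_dvd_iff)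
  then have "int q + 1 dvd b" by (simp add: add.commute)
  ultimately have "int q + 1 dvd (a - 1) - b" by (rule dvd_diff)
  then have ab1: "int q + 1 dvd (a - b) - 1" by (simp add: algebra_simps)
  have W1: "int q + 1 dvd W - (-1) ^ rank A"
  proof -
    \<comment> \<open>Modulo \<open>q + 1\<close>, \<open>q\<close> is -1.\<close>
    have "int q + 1 dvd int q ^ m - (-1) ^ m" for m
      using power_diff_sumr2[of "int q" m "-1"] by simp
    moreover have "(-1 :: int) ^ (2 * CARD('n) - rank A) = (-1) ^ rank A"
      using assms(2) by (simp add: minus_one_power_iff)
    ultimately show ?thesis unfolding W_def by metis
  qed
  have "a - b = (-1) ^ rank A * W"
  proof (rule ccontr)
    assume "a - b \<noteq> (-1) ^ rank A * W"
    then have "a - b = - ((-1) ^ rank A * W)" using ab by (auto simp: uminus_power_if)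
    \<comment> \<open>With the wrong sign, two multiples of \<open>q + 1\<close> would add up to -2,
      although \<open>q + 1\<close> is at least 3.\<close>
    then have "(a - b) - 1 + (-1) ^ rank A * (W - (-1) ^ rank A) = - 2"
      by (simp add: uminus_power_if)
    then have "int q + 1 dvd - 2" using dvd_add[OF ab1 dvd_mult[OF W1]] by metis
    then show False using q1 zdvd_imp_le[of "int q + 1" 2] by simp
  qed
  then show ?thesis by (simp add: a_def b_def W_def)
qed

text \<open>The base field is invariant under translation by 1, so the weights sum to 0 over it.
  Since 0 has weight 1, the nonzero values have total weight -1; their fibres being equally large,
  only the difference of the fibres over 0 and 1 survives.\<close>

lemma sum_herm_weight:
  fixes A :: "'a ^ 'n ^ 'n" and H :: "'a set"
  assumes A: "A \<in> hermitian_matrices q" and "rank A \<le> 2 * CARD('n)"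
    and H: "additive_subgroup H" "1 \<notin> H"
  shows "(\<Sum>x\<in>UNIV. of_bool (herm q A x \<in> H) - of_bool (herm q A x - 1 \<in> H) :: int)
    = (-1) ^ rank A * int q ^ (2 * CARD('n) - rank A)"
proof -
  let ?B = "base_field q :: 'a set"
  let ?w = "\<lambda>t. of_bool (t \<in> H) - of_bool (t - 1 \<in> H) :: int"
  let ?n = "\<lambda>c. int (card {x. herm q A x = c})"
  have B: "0 \<in> ?B" "1 \<in> ?B" using q_gt_1[OF q CARD_q] by (simp_all add: base_field_def zero_power)
  have "x + 1 \<in> ?B" "x - 1 \<in> ?B" if "x \<in> ?B" for x
    using that frobenius_add[OF q CARD_q, of x 1] frobenius_add[OF q CARD_q, of x "- 1"]
      frobenius_minus[OF q CARD_q, of 1]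
    by (simp_all add: base_field_def)
  then have "(\<Sum>t\<in>?B. of_bool (t \<in> H) :: int) = (\<Sum>t\<in>?B. of_bool (t - 1 \<in> H))"
    by (intro sum.reindex_bij_witness[of _ "\<lambda>t. t - 1" "\<lambda>t. t + 1"]) auto
  then have "(\<Sum>t\<in>?B. ?w t) = 0" by (simp add: sum_subtractf)
  moreover have w0: "?w 0 = 1"
    using H additive_subgroupD(1)[OF H(1)] additive_subgroupD(3)[OF H(1), of "- 1"] by auto
  ultimately have w: "(\<Sum>t\<in>?B - {0}. ?w t) = - 1"
    using B by (simp add: sum.remove[of ?B 0])
  have "(\<Sum>x\<in>UNIV. ?w (herm q A x)) = (\<Sum>t\<in>?B. ?n t * ?w t)"
    using sum_fun_comp[of UNIV ?B "herm q A" ?w] herm_in_base_field[OF A] by auto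
  also have "\<dots> = ?n 0 * ?w 0 + (\<Sum>t\<in>?B - {0}. ?n t * ?w t)"
    using B by (simp add: sum.remove)
  also have "(\<Sum>t\<in>?B - {0}. ?n t * ?w t) = (\<Sum>t\<in>?B - {0}. ?n 1 * ?w t)"
    by (intro sum.cong) (use card_herm_fibre_eq[of _ A] in auto)
  also have "\<dots> = - ?n 1" unfolding sum_distrib_left[symmetric] w by simp
  finally show ?thesis
    unfolding w0 using herm_fibre_difference[OF A assms(2)] by simp
qed

end

section \<open>Double counting over \<open>U\<close>\<close>

lemma linear_set_additive_subgroup:
  assumes "linear_set F U"
  shows "additive_subgroup U"
proof -
  obtain K where K: "is_subfield K" "closed_under_linear_combinations K U"
    using assms by (auto simp: linear_set_def)
  then have "1 \<in> K" "- 1 \<in> K" by (auto simp: is_subfield_def)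
  moreover have "map_matrix ((*) 1) A + map_matrix ((*) (- 1)) B = A - B" for A B :: "'a ^ 'b ^ 'c"
    by (simp add: map_matrix_def vec_eq_iff)
  ultimately show ?thesis
    using K(2) unfolding additive_subgroup_def closed_under_linear_combinations_def by metis
qed

theorem theorem3p4:
  fixes U :: "('a::{field,finite} ^ 'n ^ 'n) set" and q k :: nat
  assumes "primepow q"
    and "CARD('a) = q ^ 2"
    and "1 \<le> k" and "k \<le> CARD('n)"
    and "U \<subseteq> hermitian_matrices q"
    and "constant_rank_distance k U"
    and "linear_set (base_field q) U"
  shows "card U \<le> (if odd k then q ^ k else q ^ (2 * CARD('n) - k))"
proof -
  note q = assms(1,2)
  have q1: "q > 1" using q_gt_1[OF q] .
  have U: "additive_subgroup U" "finite U" using linear_set_additive_subgroup[OF assms(7)] by auto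
  have rank: "rank A = k" if "A \<in> U - {0}" for A
    using assms(6) that by (auto simp: constant_rank_distance_def)
  define W where "W = int q ^ (2 * CARD('n) - k)"
  have W: "W > 0" using q1 by (simp add: W_def)
  have V: "int (CARD('a ^ 'n)) = W * int q ^ k"
    using assms(4) by (simp add: W_def assms(2) flip: power_mult power_add)
  obtain H :: "'a set" where H: "additive_subgroup H" "1 \<notin> H"
    "\<And>G. additive_subgroup G \<Longrightarrow> H \<subset> G \<Longrightarrow> 1 \<in> G"
    using maximal_additive_subgroup_avoiding[of "1::'a"] by auto
  let ?w = "\<lambda>t. of_bool (t \<in> H) - of_bool (t - 1 \<in> H) :: int"
  define M where "M = int (card {x. (\<lambda>A. herm q A x) ` U \<subseteq> H})"
  \<comment> \<open>The zero vector always counts, whence \<open>M\<close> is positive.\<close>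
  have "0 \<in> {x. (\<lambda>A. herm q A x) ` U \<subseteq> H}"
    using additive_subgroupD(1)[OF H(1)] by (auto simp: sesq_def)
  then have M: "M > 0" unfolding M_def by (auto simp: card_gt_0_iff)
  have card_U: "int (card U) = 1 + int (card (U - {0}))"
    using card.remove[OF U(2) additive_subgroupD(1)[OF U(1)]] by simp
  have "(\<Sum>A\<in>U. \<Sum>x\<in>UNIV. ?w (herm q A x))
      = (\<Sum>x\<in>UNIV. ?w (herm q 0 (x::'a^'n))) + (\<Sum>A\<in>U - {0}. \<Sum>x\<in>UNIV. ?w (herm q A x))"
    by (rule sum.remove[OF U(2) additive_subgroupD(1)[OF U(1)]])
  \<comment> \<open>The zero matrix gives weight 1 at every vector: 0 lies in \<open>H\<close>, but
    -1 does not.\<close>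
  also have "(\<Sum>x\<in>UNIV. ?w (herm q 0 (x::'a^'n))) = W * int q ^ k"
    using H additive_subgroupD(1)[OF H(1)] additive_subgroupD(3)[OF H(1), of "- 1"]
    by (auto simp: sesq_def simp flip: V)
  also have "(\<Sum>A\<in>U - {0}. \<Sum>x\<in>UNIV. ?w (herm q A x)) = (\<Sum>A\<in>U - {0}. (-1) ^ k * W)"
  proof (intro sum.cong refl)
    fix A assume A: "A \<in> U - {0}"
    then show "(\<Sum>x\<in>UNIV. ?w (herm q A x)) = (-1) ^ k * W"
      using sum_herm_weight[OF q, of A H] H(1,2) rank[OF A] assms(4,5) by (auto simp: W_def)
  qed
  finally have "(\<Sum>A\<in>U. \<Sum>x\<in>UNIV. ?w (herm q A x)) = W * int q ^ k + (int (card U) - 1) * ((-1) ^ k * W)"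
    by (simp add: card_U)
  moreover have "(\<Sum>A\<in>U. \<Sum>x\<in>UNIV. ?w (herm q A x)) = int (card U) * M"
  proof -
    have "(\<Sum>A\<in>U. \<Sum>x\<in>UNIV. ?w (herm q A x)) = (\<Sum>x\<in>UNIV. \<Sum>A\<in>U. ?w (herm q A x))"
      by (rule sum.swap)
    also have "\<dots> = (\<Sum>x\<in>UNIV. if (\<lambda>A. herm q A x) ` U \<subseteq> H then int (card U) else 0)"
      by (intro sum.cong sum_coset_weight[OF H U] refl sesq_add_matrix)
    also have "\<dots> = int (card U) * M"
      by (simp add: M_def sum.If_cases mult.commute)
    finally show ?thesis .
  qed
  ultimately have main: "W * int q ^ k + (int (card U) - 1) * ((-1) ^ k * W) = int (card U) * M"
    by simp
  show ?thesis
  proof (cases "odd k")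
    case True
    have "0 < int (card U) * M" using M card_U by simp
    \<comment> \<open>The sign is negative here, and positivity gives a strict inequality that
      absorbs the summand 1.\<close>
    also have "\<dots> = W * (int q ^ k - (int (card U) - 1))"
      using main True by (simp add: algebra_simps)
    finally have "int (card U) - 1 < int (q ^ k)"
      using W by (simp add: zero_less_mult_iff)
    then have "card U \<le> q ^ k" by linarith
    with True show ?thesis by simp
  next
    case False
    have "int (card U) * (M - W) = W * (int q ^ k - 1)"
      using main False by (simp add: algebra_simps)
    then have "int (card U) dvd W * (int q ^ k - 1)" by (metis dvd_triv_left)
    moreover have "coprime (int (card U)) (int q ^ k - 1)"
    proof -
      \<comment> \<open>The right-hand side is the size of the full matrix space.\<close>
      have "card U dvd q ^ (2 * CARD('n) * CARD('n))"
        using card_additive_subgroup_dvd[OF U(1)] by (simp add: assms(2) power_mult)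
      then have "int (card U) dvd int q ^ (2 * CARD('n) * CARD('n))"
        by (metis of_nat_dvd_iff of_nat_power)
      \<comment> \<open>Here \<open>1 \<le> k\<close> enters: \<open>q\<close> divides
        \<open>q ^ k\<close>, so it is coprime to the predecessor.\<close>
      moreover have "coprime (int q) (int q ^ k - 1)"
        by (metis assms(3) coprime_power_left_iff coprime_doff_one_right not_one_le_zero)
      then have "coprime (int q ^ (2 * CARD('n) * CARD('n))) (int q ^ k - 1)" by simp
      ultimately show ?thesis by (rule coprime_divisors[OF _ dvd_refl])
    qed
    ultimately have "int (card U) dvd W" by (simp add: coprime_dvd_mult_left_iff)
    then have "int (card U) \<le> W" using W by (intro zdvd_imp_le)
    also have "W = int (q ^ (2 * CARD('n) - k))" by (simp add: W_def)
    finally show ?thesis using False by simp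
  qed
qed

end
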